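(* Let $\mathcal{H}$ be a complex Hilbert space, let $A \in \mathscr{B}(\mathcal{H})$ be a normal operator and let $g \in \mathcal{H}$. Suppose that the map $$L^2(\sigma(A), \mu_g^{(A)}) \longrightarrow \overline{\mathcal{K}(A,g)}, \qquad f \longmapsto f(A) g,$$ with $f(A) := \int_{\sigma(A)} f(z)\, \mathrm{d}E^{(A)}(z)$ understood in terms of the spectral functional calculus, is an isomorphism (a well-defined linear bijection; in particular $f(A)g \in \overline{\mathcal{K}(A,g)}$ for every $f \in L^2(\sigma(A), \mu_g^{(A)})$). Then $A$ is $\mathcal{K}(A,g)$-reduced.
   Context: $\mathscr{B}(\mathcal{H})$ denotes the bounded everywhere defined linear operators on $\mathcal{H}$, and bars over subspaces denote norm closure in $\mathcal{H}$. For $A \in \mathscr{B}(\mathcal{H})$ and $g \in \mathcal{H}$ the Krylov subspace is $\mathcal{K}(A,g) := \mathrm{span}\{A^k g \mid k \in \mathbb{N}_0\}$. $A$ is called $\mathcal{K}(A,g)$-reduced if both $\overline{\mathcal{K}(A,g)}$ and $\mathcal{K}(A,g)^\perp$ are invariant under $A$, i.e. $A\,\overline{\mathcal{K}(A,g)} \subset \overline{\mathcal{K}(A,g)}$ and $A\,\mathcal{K}(A,g)^\perp \subset \mathcal{K}(A,g)^\perp$. For a normal operator $A \in \mathscr{B}(\mathcal{H})$, $E^{(A)}$ denotes its unique projection-valued spectral measure (supported on $\sigma(A)$), and $\mu_g^{(A)}(\Omega) = \langle E^{(A)}(\Omega) g, g\rangle$ for Borel $\Omega \subset \mathbb{C}$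 is the associated scalar measure. For $f \in L^2(\sigma(A), \mu_g^{(A)})$, $f(A)$ is in general an unbounded operator, and $g$ lies in its domain. *)

theory Defs
  imports "HOL-Analysis.Analysis"
begin

text \<open>
  The underlying real Hilbert space structure (norm, topology, completeness) is the one of the
  library; the complex structure is added on top of it. Completeness together with
  \<open>inner_eq_Re_cinner\<close> makes the norm the Hilbert norm of \<open>cinner\<close>. The inner product is linear
  in its first argument.
\<close>

class chilbert_space = real_inner + complete_space +
  fixes scaleC :: "complex \<Rightarrow> 'a \<Rightarrow> 'a" (infixr "*\<^sub>C" 75)
    and cinner :: "'a \<Rightarrow> 'a \<Rightarrow> complex"
  assumes scaleC_add_right: "c *\<^sub>C (x + y) = c *\<^sub>C x + c *\<^sub>C y"
    and scaleC_add_left: "(c + d) *\<^sub>C x = c *\<^sub>C x + d *\<^sub>C x"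
    and scaleC_scaleC: "c *\<^sub>C (d *\<^sub>C x) = (c * d) *\<^sub>C x"
    and scaleR_scaleC: "r *\<^sub>R x = complex_of_real r *\<^sub>C x"
    and cinner_commute: "cinner x y = cnj (cinner y x)"
    and cinner_add_left: "cinner (x + y) z = cinner x z + cinner y z"
    and cinner_scaleC_left: "cinner (c *\<^sub>C x) y = c * cinner x y"
    and inner_eq_Re_cinner: "inner x y = Re (cinner x y)"

instance chilbert_space \<subseteq> banach ..

lemma scaleC_one: "1 *\<^sub>C (x :: 'a :: chilbert_space) = x"
  using scaleR_scaleC[of 1 x] by simp

global_interpretation complex_vector:
  vector_space "scaleC :: complex \<Rightarrow> 'a \<Rightarrow> 'a :: chilbert_space"
  by unfold_locales
    (simp_all add: scaleC_add_right scaleC_add_left scaleC_scaleC scaleC_one)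

instantiation complex :: chilbert_space
begin

definition scaleC_complex :: "complex \<Rightarrow> complex \<Rightarrow> complex" where
  "scaleC_complex c x = c * x"

definition cinner_complex :: "complex \<Rightarrow> complex \<Rightarrow> complex" where
  "cinner_complex x y = x * cnj y"

instance
  by standard
    (auto simp: scaleC_complex_def cinner_complex_def algebra_simps scaleR_conv_of_real
      inner_complex_def)

end

definition cortho :: "'a :: chilbert_space set \<Rightarrow> 'a set" where
  "cortho S = {x. \<forall>y\<in>S. cinner x y = 0}"

definition bounded_clinear :: "('a :: chilbert_space \<Rightarrow> 'a) \<Rightarrow> bool" where
  "bounded_clinear A \<longleftrightarrow> bounded_linear A \<and> (\<forall>c x. A (c *\<^sub>C x) = c *\<^sub>C A x)"

definition cadjoint :: "('a :: chilbert_space \<Rightarrow> 'a) \<Rightarrow> 'a \<Rightarrow> 'a" where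
  "cadjoint A = (THE B. \<forall>x y. cinner (A x) y = cinner x (B y))"

definition normal_operator :: "('a :: chilbert_space \<Rightarrow> 'a) \<Rightarrow> bool" where
  "normal_operator A \<longleftrightarrow> bounded_clinear A \<and> A \<circ> cadjoint A = cadjoint A \<circ> A"

definition spectrum :: "('a :: chilbert_space \<Rightarrow> 'a) \<Rightarrow> complex set" where
  "spectrum A = {z. \<not> (\<exists>R. bounded_clinear R \<and>
     (\<forall>x. R (A x - z *\<^sub>C x) = x) \<and> (\<forall>x. A (R x) - z *\<^sub>C R x = x))}"

definition krylov :: "('a :: chilbert_space \<Rightarrow> 'a) \<Rightarrow> 'a \<Rightarrow> 'a set" where
  "krylov A g = complex_vector.span {(A ^^ k) g | k. True}"

definition krylov_reduced :: "('a :: chilbert_space \<Rightarrow> 'a) \<Rightarrow> 'a \<Rightarrow> bool" where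
  "krylov_reduced A g \<longleftrightarrow>
     A ` closure (krylov A g) \<subseteq> closure (krylov A g) \<and>
     A ` cortho (krylov A g) \<subseteq> cortho (krylov A g)"

definition orthogonal_projection :: "('a :: chilbert_space \<Rightarrow> 'a) \<Rightarrow> bool" where
  "orthogonal_projection P \<longleftrightarrow> bounded_clinear P \<and> P \<circ> P = P \<and>
     (\<forall>x y. cinner (P x) y = cinner x (P y))"

text \<open>Only the values of \<open>E\<close> on Borel sets are meaningful; countable additivity is strong.\<close>

definition projection_valued_measure ::
    "(complex set \<Rightarrow> 'a :: chilbert_space \<Rightarrow> 'a) \<Rightarrow> bool" where
  "projection_valued_measure E \<longleftrightarrow>
     (\<forall>\<Omega>\<in>sets borel. orthogonal_projection (E \<Omega>)) \<and>
     E UNIV = id \<and>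
     (\<forall>B :: nat \<Rightarrow> complex set. range B \<subseteq> sets borel \<longrightarrow> disjoint_family B \<longrightarrow>
        (\<forall>x. (\<lambda>n. E (B n) x) sums E (\<Union>n. B n) x))"

definition scalar_measure ::
    "(complex set \<Rightarrow> 'a :: chilbert_space \<Rightarrow> 'a) \<Rightarrow> 'a \<Rightarrow> complex measure" where
  "scalar_measure E g = measure_of UNIV (sets borel) (\<lambda>\<Omega>. ennreal (Re (cinner (E \<Omega> g) g)))"

definition simple_spectral_integral ::
    "(complex set \<Rightarrow> 'a :: chilbert_space \<Rightarrow> 'a) \<Rightarrow> (complex \<Rightarrow> complex) \<Rightarrow> 'a \<Rightarrow> 'a" where
  "simple_spectral_integral E s x = (\<Sum>c\<in>range s. c *\<^sub>C E (s -` {c}) x)"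

text \<open>
  \<open>has_spectral_integral E S f x y\<close> says that \<open>x\<close> lies in the domain of the (in general unbounded)
  operator \<open>\<integral>\<^sub>S f dE\<close>, i.e. that \<open>f\<close> is square-integrable on \<open>S\<close> for the scalar measure of \<open>x\<close>,
  and that this operator maps \<open>x\<close> to \<open>y\<close>: as in \<open>has_bochner_integral\<close>, \<open>y\<close> is the limit of the
  integrals of simple functions, which here approximate \<open>f\<close> in \<open>L\<^sup>2\<close>. As in
  \<open>set_lebesgue_integral\<close>, integration over \<open>S\<close> is integration after multiplication with the
  indicator of \<open>S\<close>.
\<close>

definition has_spectral_integral ::
    "(complex set \<Rightarrow> 'a :: chilbert_space \<Rightarrow> 'a) \<Rightarrow> complex set \<Rightarrow> (complex \<Rightarrow> complex) \<Rightarrow>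
      'a \<Rightarrow> 'a \<Rightarrow> bool" where
  "has_spectral_integral E S f x y \<longleftrightarrow>
     (\<lambda>z. indicator S z * f z) \<in> borel_measurable borel \<and>
     (\<exists>s :: nat \<Rightarrow> complex \<Rightarrow> complex. (\<forall>n. simple_function borel (s n)) \<and>
        (\<lambda>n. \<integral>\<^sup>+z. ennreal ((cmod (indicator S z * f z - s n z))\<^sup>2) \<partial>scalar_measure E x)
          \<longlonglongrightarrow> 0 \<and>
        (\<lambda>n. simple_spectral_integral E (s n) x) \<longlonglongrightarrow> y)"

definition spectral_integral ::
    "(complex set \<Rightarrow> 'a :: chilbert_space \<Rightarrow> 'a) \<Rightarrow> complex set \<Rightarrow> (complex \<Rightarrow> complex) \<Rightarrow>
      'a \<Rightarrow> 'a" where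
  "spectral_integral E S f x = (THE y. has_spectral_integral E S f x y)"

text \<open>
  By the spectral theorem every normal operator \<open>A\<close> has such an \<open>E\<close>, and its values on Borel
  sets are determined by \<open>A\<close>; a relation is used since the other values of \<open>E\<close> are
  arbitrary. \<open>E\<close> is supported on the
  spectrum of \<open>A\<close>, and \<open>A\<close> is the integral of the identity function against it.
\<close>

definition is_spectral_measure ::
    "('a :: chilbert_space \<Rightarrow> 'a) \<Rightarrow> (complex set \<Rightarrow> 'a \<Rightarrow> 'a) \<Rightarrow> bool" where
  "is_spectral_measure A E \<longleftrightarrow>
     projection_valued_measure E \<and> E (spectrum A) = id \<and>
     (\<forall>x. has_spectral_integral E (spectrum A) (\<lambda>z. z) x (A x))"

definition L2 :: "complex measure \<Rightarrow> (complex \<Rightarrow> complex) set" where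
  "L2 M = {f \<in> borel_measurable M. integrable M (\<lambda>z. (cmod (f z))\<^sup>2)}"

definition L2_eq :: "complex measure \<Rightarrow> ((complex \<Rightarrow> complex) \<times> (complex \<Rightarrow> complex)) set" where
  "L2_eq M = {(f, h). f \<in> L2 M \<and> h \<in> L2 M \<and> (AE z in M. f z = h z)}"

text \<open>
  \<open>T\<close> acts on representatives; it is required to be constant on the classes of almost everywhere
  equal functions, so that it induces the map \<open>F \<mapsto> the_elem (T ` F)\<close> on the quotient, which has
  to be a bijection onto \<open>V\<close>.
\<close>

definition L2_isomorphism ::
    "complex measure \<Rightarrow> ((complex \<Rightarrow> complex) \<Rightarrow> 'a) \<Rightarrow> 'a :: chilbert_space set \<Rightarrow> bool" where
  "L2_isomorphism M T V \<longleftrightarrow>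
     (\<forall>f\<in>L2 M. T f \<in> V) \<and>
     congruent (L2_eq M) T \<and>
     (\<forall>f\<in>L2 M. \<forall>h\<in>L2 M. T (\<lambda>z. f z + h z) = T f + T h) \<and>
     (\<forall>c. \<forall>f\<in>L2 M. T (\<lambda>z. c * f z) = c *\<^sub>C T f) \<and>
     bij_betw (\<lambda>F. the_elem (T ` F)) (L2 M // L2_eq M) V"

end

theory Submission
  imports Defs
begin

text \<open>
  Applied to indicator functions, the isomorphism gives
  \<open>E \<Omega> g \<in> closure (krylov A g)\<close> for every Borel set \<open>\<Omega>\<close>. Let \<open>W\<close> be the orthogonal complement
  of all the vectors \<open>E \<Omega> g\<close>. Since the projections are self-adjoint and multiplicative, \<open>W\<close>
  and its orthogonal complement are invariant under \<open>E\<close>. As \<open>A x\<close> is a limit of integrals of simple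
  functions applied to \<open>x\<close>, every closed subspace invariant under \<open>E\<close> is invariant under \<open>A\<close>.
  Hence \<open>A\<close> preserves \<open>W\<close>, and also its complement, which contains \<open>g\<close> and therefore
  \<open>krylov A g\<close>; so \<open>W\<close> is the complement of \<open>krylov A g\<close>.
\<close>

section \<open>Orthogonal complements\<close>

lemma cinner_add_right: "cinner x (y + z) = cinner x y + cinner x z"
  by (metis cinner_add_left cinner_commute complex_cnj_add)

lemma cinner_scaleC_right: "cinner x (c *\<^sub>C y) = cnj c * cinner x y"
  by (metis cinner_commute cinner_scaleC_left complex_cnj_mult)

lemma cinner_zero_left [simp]: "cinner 0 x = 0"
  using cinner_add_left[of 0 0 x] by simp

lemma cinner_zero_right [simp]: "cinner x 0 = 0"
  using cinner_add_right[of x 0 0] by simp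

lemma cinner_sum_left: "cinner (\<Sum>i\<in>I. f i) y = (\<Sum>i\<in>I. cinner (f i) y)"
  by (induction I rule: infinite_finite_induct) (auto simp: cinner_add_left)

lemma cinner_sum_right: "cinner y (\<Sum>i\<in>I. f i) = (\<Sum>i\<in>I. cinner y (f i))"
  by (induction I rule: infinite_finite_induct) (auto simp: cinner_add_right)

lemma cinner_eq_0_commute: "cinner x y = 0 \<longleftrightarrow> cinner y x = 0"
  by (metis cinner_commute complex_cnj_zero_iff)

lemma norm_eq_cinner: "(norm x)\<^sup>2 = Re (cinner x x)"
  by (simp add: power2_norm_eq_inner inner_eq_Re_cinner)

text \<open>Multiplying \<open>y\<close> by the imaginary unit exposes the imaginary part, so a
  complex orthogonality condition becomes two conditions on the real inner product, whose continuity
  is at hand.\<close>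

lemma cinner_eq_Complex: "cinner x y = Complex (inner x y) (inner x (\<i> *\<^sub>C y))"
  by (simp add: complex_eq_iff inner_eq_Re_cinner cinner_scaleC_right)

lemma closed_cortho: "closed (cortho S)"
proof -
  have "cortho S = (\<Inter>y\<in>S. {x. inner x y = 0} \<inter> {x. inner x (\<i> *\<^sub>C y) = 0})"
    by (auto simp: cortho_def cinner_eq_Complex complex_eq_iff)
  then show ?thesis
    by (auto intro!: closed_INT closed_Int closed_Collect_eq continuous_intros)
qed

lemma subspace_cortho: "complex_vector.subspace (cortho S)"
  by (auto simp: complex_vector.subspace_def cortho_def cinner_add_left cinner_scaleC_left)

text \<open>Orthogonality is symmetric: \<open>x\<close> is orthogonal to \<open>S\<close> iff
  \<open>S\<close> lies in \<open>cortho {x}\<close>, and this set is closed.\<close>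

lemma cortho_closure: "cortho (closure S) = cortho S"
proof
  show "cortho (closure S) \<subseteq> cortho S"
    using closure_subset by (auto simp: cortho_def)
  show "cortho S \<subseteq> cortho (closure S)"
  proof
    fix x assume "x \<in> cortho S"
    then have "S \<subseteq> cortho {x}"
      by (auto simp: cortho_def cinner_eq_0_commute)
    then have "closure S \<subseteq> cortho {x}"
      by (simp add: closed_cortho closure_minimal)
    then show "x \<in> cortho (closure S)"
      by (auto simp: cortho_def cinner_eq_0_commute)
  qed
qed

lemma cortho_antimono: "S \<subseteq> T \<Longrightarrow> cortho T \<subseteq> cortho S"
  by (auto simp: cortho_def)

section \<open>Krylov subspaces\<close>

lemma krylov_subset:
  assumes "complex_vector.subspace V" and "g \<in> V" and "A ` V \<subseteq> V"
  shows "krylov A g \<subseteq> V"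
proof -
  have "(A ^^ k) g \<in> V" for k
    using assms by (induction k) auto
  then show ?thesis
    unfolding krylov_def by (intro complex_vector.span_minimal assms(1)) auto
qed

lemma krylov_invariant:
  assumes "bounded_clinear A"
  shows "A ` krylov A g \<subseteq> krylov A g"
proof (rule image_subsetI)
  have lin: "linear A" and scale: "A (c *\<^sub>C x) = c *\<^sub>C A x" for c x
    using assms by (auto simp: bounded_clinear_def bounded_linear.linear)
  fix x assume "x \<in> krylov A g"
  then have "x \<in> complex_vector.span {(A ^^ k) g | k. True}"
    by (simp add: krylov_def)
  then show "A x \<in> krylov A g"
  proof (induction rule: complex_vector.span_induct)
    case base
    have "A (x + y) = A x + A y" "A 0 = 0" for x y
      using lin by (auto simp: linear_add linear_0)
    then show ?case
      by (auto simp: complex_vector.subspace_def krylov_def scale complex_vector.span_zero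
          complex_vector.span_add complex_vector.span_scale)
  next
    case (step x)
    then obtain k where "A x = (A ^^ Suc k) g"
      by auto
    then show ?case
      unfolding krylov_def by (intro complex_vector.span_base) blast
  qed
qed

lemma closure_krylov_invariant:
  assumes "bounded_clinear A"
  shows "A ` closure (krylov A g) \<subseteq> closure (krylov A g)"
proof (rule image_closure_subset)
  show "continuous_on (closure (krylov A g)) A"
    using assms by (simp add: bounded_clinear_def linear_continuous_on)
  show "A ` krylov A g \<subseteq> closure (krylov A g)"
    using krylov_invariant[OF assms] closure_subset by blast
qed simp

section \<open>Projection-valued measures\<close>

lemma sets_scalar_measure [simp, measurable_cong]: "sets (scalar_measure E x) = sets borel"
  unfolding scalar_measure_def by (metis sets.sets_measure_of_eq space_borel)

lemma space_scalar_measure [simp]: "space (scalar_measure E x) = UNIV"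
  unfolding scalar_measure_def by (simp add: space_measure_of_conv)

context
  fixes E :: "complex set \<Rightarrow> 'a :: chilbert_space \<Rightarrow> 'a"
  assumes pvm: "projection_valued_measure E"
begin

lemma pvm_projection: "X \<in> sets borel \<Longrightarrow> orthogonal_projection (E X)"
  using pvm by (simp add: projection_valued_measure_def)

lemma pvm_UNIV: "E UNIV x = x"
  using pvm by (simp add: projection_valued_measure_def)

lemma pvm_sums:
  "range B \<subseteq> sets borel \<Longrightarrow> disjoint_family B \<Longrightarrow> (\<lambda>n. E (B n) x) sums E (\<Union>n. B n) x"
  using pvm by (simp add: projection_valued_measure_def)

lemma pvm_self_adjoint: "X \<in> sets borel \<Longrightarrow> cinner (E X x) y = cinner x (E X y)"
  using pvm_projection by (simp add: orthogonal_projection_def)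

lemma pvm_idem: "X \<in> sets borel \<Longrightarrow> E X (E X x) = E X x"
  using pvm_projection by (metis orthogonal_projection_def comp_apply)

lemma pvm_linear: "X \<in> sets borel \<Longrightarrow> linear (E X)"
  using pvm_projection
  by (auto simp: orthogonal_projection_def bounded_clinear_def bounded_linear.linear)

lemma pvm_empty: "E {} x = 0"
proof -
  \<comment> \<open>A convergent series with constant terms forces the term to vanish.\<close>
  have "(\<lambda>n :: nat. E {} x) sums E (\<Union>n :: nat. {}) x"
    by (rule pvm_sums) (auto simp: disjoint_family_on_def)
  then have "(\<lambda>n :: nat. E {} x) \<longlonglongrightarrow> 0"
    by (blast intro: summable_LIMSEQ_zero sums_summable)
  then show ?thesis
    by (simp add: LIMSEQ_const_iff)
qed

lemma pvm_Un:
  assumes "X \<in> sets borel" "Y \<in> sets borel" "X \<inter> Y = {}"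
  shows "E (X \<union> Y) x = E X x + E Y x"
proof -
  \<comment> \<open>\<open>binaryset X Y\<close> is the sequence X, Y, {}, {}, ..., so the series
    has only two terms that can be nonzero.\<close>
  have "(\<lambda>n. E (binaryset X Y n) x) sums E (\<Union>n. binaryset X Y n) x"
    using assms
    by (intro pvm_sums) (auto simp: binaryset_def disjoint_family_on_def)
  moreover have "(\<lambda>n. E (binaryset X Y n) x) sums (\<Sum>n\<in>{0, 1}. E (binaryset X Y n) x)"
    by (rule sums_finite) (auto simp: binaryset_def pvm_empty)
  ultimately show ?thesis
    by (auto simp: UN_binaryset_eq binaryset_def dest: sums_unique2)
qed

lemma pvm_UN_finite:
  assumes "finite I" "\<And>i. i \<in> I \<Longrightarrow> B i \<in> sets borel" "disjoint_family_on B I"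
  shows "E (\<Union>i\<in>I. B i) x = (\<Sum>i\<in>I. E (B i) x)"
  using assms
proof (induction I rule: finite_induct)
  case empty
  then show ?case by (simp add: pvm_empty)
next
  case (insert i I)
  have "E (B i \<union> (\<Union>i\<in>I. B i)) x = E (B i) x + E (\<Union>i\<in>I. B i) x"
    using insert.hyps insert.prems
    by (intro pvm_Un sets.finite_UN) (auto simp: disjoint_family_on_def)
  also have "E (\<Union>i\<in>I. B i) x = (\<Sum>i\<in>I. E (B i) x)"
    using insert.prems by (intro insert.IH) (auto simp: disjoint_family_on_def)
  finally show ?case
    using insert.hyps by simp
qed

text \<open>
  For disjoint sets \<open>E X + E Y\<close> is idempotent, so \<open>E X\<close> and \<open>E Y\<close> anticommute; composing with
  \<open>E X\<close> on either side shows that they also commute.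
\<close>

lemma pvm_disjoint:
  assumes X: "X \<in> sets borel" and Y: "Y \<in> sets borel" and "X \<inter> Y = {}"
  shows "E X (E Y x) = 0"
proof -
  note add = linear_add[OF pvm_linear[OF X]] linear_add[OF pvm_linear[OF Y]]
  have anti: "E X (E Y x) = - E Y (E X x)" for x
    using pvm_idem[of "X \<union> Y" x] assms
    by (simp add: pvm_Un add pvm_idem add_eq_0_iff algebra_simps)
  have "E X (E Y x) = E X (E X (E Y x))"
    using X by (simp add: pvm_idem)
  also have "\<dots> = - E X (E Y (E X x))"
    by (subst anti) (simp add: linear_neg[OF pvm_linear[OF X]])
  also have "\<dots> = E Y (E X x)"
    by (subst anti) (simp add: pvm_idem[OF X])
  also have "\<dots> = - E X (E Y x)"
    by (simp add: anti)
  finally show ?thesis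
    by (simp add: eq_neg_iff_add_eq_0 flip: scaleR_2)
qed

text \<open>Split both sets along the intersection: of the resulting products all vanish by
  disjointness except the square of \<open>E (X \<inter> Y)\<close>.\<close>

lemma pvm_Int:
  assumes X: "X \<in> sets borel" and Y: "Y \<in> sets borel"
  shows "E X (E Y x) = E (X \<inter> Y) x"
proof -
  have disj: "X \<inter> (Y - X) = {}" "(X \<inter> Y) \<inter> (X - Y) = {}" "(X - Y) \<inter> (X \<inter> Y) = {}"
    "(X \<inter> Y) \<inter> (Y - X) = {}"
    and un: "(X \<inter> Y) \<union> (X - Y) = X" "(X \<inter> Y) \<union> (Y - X) = Y"
    by auto
  have meas: "X \<inter> Y \<in> sets borel" "X - Y \<in> sets borel" "Y - X \<in> sets borel"
    using assms by auto
  have "E X (E Y x) = E X (E (X \<inter> Y) x) + E X (E (Y - X) x)"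
    using pvm_Un[OF meas(1,3) disj(4), of x] by (simp add: un linear_add[OF pvm_linear[OF X]])
  also have "E X (E (Y - X) x) = 0"
    by (rule pvm_disjoint[OF X meas(3) disj(1)])
  also have "E X (E (X \<inter> Y) x) = E (X \<inter> Y) (E (X \<inter> Y) x) + E (X - Y) (E (X \<inter> Y) x)"
    using pvm_Un[OF meas(1,2) disj(2), of "E (X \<inter> Y) x"] by (simp only: un)
  also have "\<dots> = E (X \<inter> Y) x"
    by (simp only: pvm_idem[OF meas(1)] pvm_disjoint[OF meas(2,1) disj(3)] add_0_right)
  finally show ?thesis
    by simp
qed

lemma pvm_norm: "X \<in> sets borel \<Longrightarrow> (norm (E X x))\<^sup>2 = Re (cinner (E X x) x)"
  by (metis norm_eq_cinner pvm_idem pvm_self_adjoint)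

lemma pvm_nonneg: "X \<in> sets borel \<Longrightarrow> 0 \<le> Re (cinner (E X x) x)"
  by (metis pvm_norm zero_le_power2)

lemma emeasure_scalar_measure:
  assumes "X \<in> sets borel"
  shows "emeasure (scalar_measure E x) X = ennreal (Re (cinner (E X x) x))"
  unfolding scalar_measure_def
proof (rule emeasure_measure_of_sigma)
  show "sigma_algebra UNIV (sets (borel :: complex measure))"
    using sets.sigma_algebra_axioms[of "borel :: complex measure"] by simp
  show "positive (sets borel) (\<lambda>X. ennreal (Re (cinner (E X x) x)))"
    by (simp add: positive_def pvm_empty)
  show "countably_additive (sets borel) (\<lambda>X. ennreal (Re (cinner (E X x) x)))"
  proof (rule countably_additiveI)
    fix B :: "nat \<Rightarrow> complex set"
    assume B: "range B \<subseteq> sets borel" "disjoint_family B"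
    \<comment> \<open>Pairing with \<open>x\<close> is a bounded linear functional, so it carries
      strong additivity of \<open>E\<close> over to the scalar values.\<close>
    then have "(\<lambda>n. inner (E (B n) x) x) sums inner (E (\<Union>n. B n) x) x"
      by (intro bounded_linear.sums[OF bounded_linear_inner_left] pvm_sums)
    moreover have "0 \<le> inner (E (B n) x) x" for n
      using B(1) by (auto simp: inner_eq_Re_cinner intro!: pvm_nonneg)
    ultimately show "(\<Sum>n. ennreal (Re (cinner (E (B n) x) x))) =
        ennreal (Re (cinner (E (\<Union>n. B n) x) x))"
      by (subst suminf_ennreal2) (auto simp: inner_eq_Re_cinner sums_iff)
  qed
qed fact

lemma finite_scalar_measure: "finite_measure (scalar_measure E x)"
  by (rule finite_measureI) (simp add: emeasure_scalar_measure)

section \<open>Integrals of simple functions\<close>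

text \<open>\<open>h\<close> may merge level sets of \<open>u\<close>; finite additivity makes the
  sum over the finer partition agree with the one over the values of the composition. Here
  \<open>u\<close> may take values in any type, which permits common refinements.\<close>

lemma simple_spectral_integral_comp:
  assumes u: "simple_function borel u"
  shows "simple_spectral_integral E (\<lambda>z. h (u z)) x = (\<Sum>b\<in>range u. h b *\<^sub>C E (u -` {b}) x)"
proof -
  have fin: "finite (range u)" and meas: "b \<in> range u \<Longrightarrow> u -` {b} \<in> sets borel" for b
    using u by (auto simp: simple_function_def)
  have "E ((\<lambda>z. h (u z)) -` {c}) x = (\<Sum>b\<in>{b \<in> range u. h b = c}. E (u -` {b}) x)" for c
  proof -
    have "(\<lambda>z. h (u z)) -` {c} = (\<Union>b\<in>{b \<in> range u. h b = c}. u -` {b})"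
      by auto
    then show ?thesis
      using fin meas by (auto intro!: pvm_UN_finite simp: disjoint_family_on_def)
  qed
  then have "simple_spectral_integral E (\<lambda>z. h (u z)) x =
      (\<Sum>c\<in>h ` range u. \<Sum>b\<in>{b \<in> range u. h b = c}. h b *\<^sub>C E (u -` {b}) x)"
    by (auto simp: simple_spectral_integral_def complex_vector.scale_sum_right image_image
        intro!: sum.cong)
  also have "\<dots> = (\<Sum>b\<in>range u. h b *\<^sub>C E (u -` {b}) x)"
    using fin by (rule sum.image_gen[symmetric])
  finally show ?thesis .
qed

lemma simple_spectral_integral_diff:
  assumes "simple_function borel s" "simple_function borel t"
  shows "simple_spectral_integral E (\<lambda>z. s z - t z) x =
    simple_spectral_integral E s x - simple_spectral_integral E t x"
proof -
  \<comment> \<open>The level sets of the pair refine those of \<open>s\<close>, of \<open>t\<close>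
    and of their difference, so all three integrals become sums over one partition.\<close>
  define u where "u = (\<lambda>z. (s z, t z))"
  have u: "simple_function borel u"
    unfolding u_def using assms by (rule simple_function_Pair)
  show ?thesis
    using simple_spectral_integral_comp[OF u, of fst x] simple_spectral_integral_comp[OF u, of snd x]
      simple_spectral_integral_comp[OF u, of "\<lambda>p. fst p - snd p" x]
    by (simp add: u_def complex_vector.scale_left_diff_distrib sum_subtractf)
qed

lemma nn_integral_simple_square:
  assumes s: "simple_function borel s"
  shows "(\<integral>\<^sup>+z. ennreal ((cmod (s z))\<^sup>2) \<partial>scalar_measure E x) =
    ennreal ((norm (simple_spectral_integral E s x))\<^sup>2)"
proof -
  have fin: "finite (range s)" and meas: "c \<in> range s \<Longrightarrow> s -` {c} \<in> sets borel" for c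
    using s by (auto simp: simple_function_def)
  \<comment> \<open>At each point only the summand with \<open>c = s z\<close> survives.\<close>
  have "ennreal ((cmod (s z))\<^sup>2) =
      (\<Sum>c\<in>range s. ennreal ((cmod c)\<^sup>2) * indicator (s -` {c}) z)" for z
  proof -
    have "(\<Sum>c\<in>range s. ennreal ((cmod c)\<^sup>2) * indicator (s -` {c}) z) =
        (\<Sum>c\<in>range s. if c = s z then ennreal ((cmod c)\<^sup>2) else 0)"
      by (auto intro!: sum.cong simp: indicator_def)
    then show ?thesis
      using fin by simp
  qed
  then have "(\<integral>\<^sup>+z. ennreal ((cmod (s z))\<^sup>2) \<partial>scalar_measure E x) =
      (\<Sum>c\<in>range s. \<integral>\<^sup>+z. ennreal ((cmod c)\<^sup>2) * indicator (s -` {c}) z \<partial>scalar_measure E x)"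
    using meas by (simp only:) (rule nn_integral_sum, auto)
  also have "\<dots> = (\<Sum>c\<in>range s. ennreal ((cmod c)\<^sup>2 * Re (cinner (E (s -` {c}) x) x)))"
    using meas by (intro sum.cong refl)
      (simp add: nn_integral_cmult_indicator emeasure_scalar_measure ennreal_mult pvm_nonneg)
  also have "\<dots> = ennreal (\<Sum>c\<in>range s. (cmod c)\<^sup>2 * Re (cinner (E (s -` {c}) x) x))"
    using meas by (intro sum_ennreal) (simp add: pvm_nonneg)
  also have "(\<Sum>c\<in>range s. (cmod c)\<^sup>2 * Re (cinner (E (s -` {c}) x) x)) =
      (norm (simple_spectral_integral E s x))\<^sup>2"
  proof -
    have "cinner (E (s -` {c}) x) (E (s -` {d}) x) =
        (if c = d then cinner (E (s -` {c}) x) x else 0)"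
      if "c \<in> range s" "d \<in> range s" for c d
    proof (cases "c = d")
      case True
      then show ?thesis
        using that meas by (metis pvm_idem pvm_self_adjoint)
    next
      case False
      then have "s -` {c} \<inter> s -` {d} = {}"
        by auto
      then show ?thesis
        using False that meas by (simp add: pvm_self_adjoint pvm_disjoint)
    qed
    then have "cinner (simple_spectral_integral E s x) (simple_spectral_integral E s x) =
        (\<Sum>c\<in>range s. \<Sum>d\<in>range s.
          if c = d then c * cnj c * cinner (E (s -` {c}) x) x else 0)"
      unfolding simple_spectral_integral_def cinner_sum_left
      unfolding cinner_sum_right cinner_scaleC_left cinner_scaleC_right
      by (intro sum.cong refl) simp
    also have "\<dots> = (\<Sum>c\<in>range s. of_real ((cmod c)\<^sup>2) * cinner (E (s -` {c}) x) x)"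
      using fin by (simp add: complex_norm_square del: of_real_power)
    finally show ?thesis
      by (simp add: norm_eq_cinner del: of_real_power)
  qed
  finally show ?thesis .
qed

text \<open>By the isometry, approximation of a simple function in the square mean forces the simple
  integrals to converge in norm to its own integral, which gives uniqueness. For existence the
  constant sequence serves. Thus the description in \<open>spectral_integral\<close> is unique
  here.\<close>

lemma has_spectral_integral_simple_iff:
  assumes f: "simple_function borel (\<lambda>z. indicator S z * f z)"
  shows "has_spectral_integral E S f x y \<longleftrightarrow>
    y = simple_spectral_integral E (\<lambda>z. indicator S z * f z) x"
proof
  let ?f = "\<lambda>z. indicator S z * f z"
  assume "has_spectral_integral E S f x y"
  then obtain s where s: "\<And>n. simple_function borel (s n)"
    and lim: "(\<lambda>n. \<integral>\<^sup>+z. ennreal ((cmod (?f z - s n z))\<^sup>2) \<partial>scalar_measure E x) \<longlonglongrightarrow> 0"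
    and y: "(\<lambda>n. simple_spectral_integral E (s n) x) \<longlonglongrightarrow> y"
    unfolding has_spectral_integral_def by blast
  let ?d = "\<lambda>n. simple_spectral_integral E ?f x - simple_spectral_integral E (s n) x"
  have "(\<integral>\<^sup>+z. ennreal ((cmod (?f z - s n z))\<^sup>2) \<partial>scalar_measure E x) = ennreal ((norm (?d n))\<^sup>2)" for n
    using nn_integral_simple_square[OF simple_function_diff[OF f s[of n]], of x]
    by (simp only: simple_spectral_integral_diff[OF f s[of n]])
  with lim have "(\<lambda>n. ennreal ((norm (?d n))\<^sup>2)) \<longlonglongrightarrow> ennreal 0"
    by (simp only: ennreal_0)
  then have "(\<lambda>n. (norm (?d n))\<^sup>2) \<longlonglongrightarrow> 0"
    by (rule tendsto_ennrealD) auto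
  then have "(\<lambda>n. sqrt ((norm (?d n))\<^sup>2)) \<longlonglongrightarrow> sqrt 0"
    by (rule tendsto_real_sqrt)
  then have "?d \<longlonglongrightarrow> 0"
    by (simp add: tendsto_norm_zero_iff)
  moreover have "?d \<longlonglongrightarrow> simple_spectral_integral E ?f x - y"
    by (intro tendsto_intros y)
  ultimately show "y = simple_spectral_integral E ?f x"
    using LIMSEQ_unique by fastforce
next
  assume "y = simple_spectral_integral E (\<lambda>z. indicator S z * f z) x"
  then show "has_spectral_integral E S f x y"
    unfolding has_spectral_integral_def
    by (intro conjI exI[of _ "\<lambda>_ z. indicator S z * f z"] allI f
        borel_measurable_simple_function) simp_all
qed

lemma spectral_integral_indicator:
  assumes "S \<in> sets borel" "X \<in> sets borel"
  shows "spectral_integral E S (indicator X) x = E (S \<inter> X) x"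
proof -
  have eq: "(\<lambda>z. indicator S z * indicator X z) = (indicator (S \<inter> X) :: complex \<Rightarrow> complex)"
    by (simp add: indicator_inter_arith fun_eq_iff)
  have u: "simple_function borel (indicator (S \<inter> X) :: complex \<Rightarrow> complex)"
    using assms by (intro simple_function_indicator) auto
  have "simple_spectral_integral E (indicator (S \<inter> X)) x =
      (\<Sum>c\<in>range (indicator (S \<inter> X)). c *\<^sub>C E (indicator (S \<inter> X) -` {c}) x)"
    by (simp add: simple_spectral_integral_def)
  \<comment> \<open>The indicator misses the value 1 or 0 when \<open>S \<inter> X\<close> is empty
    or everything; the extra summand is then zero because its level set is empty.\<close>
  also have "\<dots> = (\<Sum>c\<in>{0, 1}. c *\<^sub>C E (indicator (S \<inter> X) -` {c}) x)"
  proof (rule sum.mono_neutral_left)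
    show "\<forall>c\<in>{0, 1} - range (indicator (S \<inter> X)). c *\<^sub>C E (indicator (S \<inter> X) -` {c}) x = 0"
    proof
      fix c :: complex
      assume "c \<in> {0, 1} - range (indicator (S \<inter> X))"
      then have "indicator (S \<inter> X) -` {c} = {}"
        by auto
      then show "c *\<^sub>C E (indicator (S \<inter> X) -` {c}) x = 0"
        by (simp add: pvm_empty)
    qed
  qed (auto simp: indicator_def)
  also have "\<dots> = E (indicator (S \<inter> X) -` {1 :: complex}) x"
    by (simp add: scaleC_one)
  also have "indicator (S \<inter> X) -` {1 :: complex} = S \<inter> X"
    by (auto simp: indicator_def)
  finally have "simple_spectral_integral E (indicator (S \<inter> X)) x = E (S \<inter> X) x" .
  then have "has_spectral_integral E S (indicator X) x y \<longleftrightarrow> y = E (S \<inter> X) x" for y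
    using has_spectral_integral_simple_iff[of S "indicator X"] by (simp add: eq u)
  then show ?thesis
    unfolding spectral_integral_def by (intro the_equality) auto
qed

section \<open>Invariant subspaces\<close>

text \<open>The approximating simple integrals are linear combinations of the vectors
  \<open>E X x\<close>, hence lie in \<open>V\<close>, and closedness passes this to their
  limit.\<close>

lemma has_spectral_integral_mem:
  assumes V: "complex_vector.subspace V" "closed V"
    and inv: "\<And>X. X \<in> sets borel \<Longrightarrow> E X x \<in> V"
    and int: "has_spectral_integral E S f x y"
  shows "y \<in> V"
proof -
  obtain s where s: "\<And>n. simple_function borel (s n)"
    and y: "(\<lambda>n. simple_spectral_integral E (s n) x) \<longlonglongrightarrow> y"
    using int unfolding has_spectral_integral_def by blast
  have "simple_spectral_integral E (s n) x \<in> V" for n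
    unfolding simple_spectral_integral_def
    using s[of n] V(1)
    by (intro complex_vector.subspace_sum complex_vector.subspace_scale inv)
      (auto simp: simple_function_def)
  then show ?thesis
    using V(2) y by (metis closed_sequentially)
qed

lemma cortho_pvm_invariant:
  assumes "\<And>X v. X \<in> sets borel \<Longrightarrow> v \<in> V \<Longrightarrow> E X v \<in> V"
    and "X \<in> sets borel" "x \<in> cortho V"
  shows "E X x \<in> cortho V"
  using assms by (auto simp: cortho_def pvm_self_adjoint)

end

text \<open>The definition of the spectral integral of the identity includes measurability of its
  product with the indicator of the spectrum. The nonzero set of this product is the spectrum
  without 0, and the point 0 is treated separately.\<close>

lemma spectrum_borel:
  assumes "is_spectral_measure A E"
  shows "spectrum A \<in> sets borel"
proof -
  have "(\<lambda>z. indicator (spectrum A) z * z) \<in> borel_measurable borel"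
    using assms by (auto simp: is_spectral_measure_def has_spectral_integral_def)
  then have "(\<lambda>z. indicator (spectrum A) z * z) -` (- {0}) \<inter> space borel \<in> sets borel"
    by (rule measurable_sets) auto
  also have "(\<lambda>z. indicator (spectrum A) z * z) -` (- {0}) \<inter> space borel = spectrum A - {0}"
    by (auto simp: indicator_def)
  finally have "spectrum A - {0} \<in> sets borel" .
  moreover have "spectrum A \<inter> {0} \<in> sets borel"
    by (cases "0 \<in> spectrum A") auto
  ultimately show ?thesis
    by (metis Un_Diff_Int sets.Un)
qed

theorem theorem4p4:
  fixes A :: "'a :: chilbert_space \<Rightarrow> 'a"
    and g :: 'a
    and E :: "complex set \<Rightarrow> 'a \<Rightarrow> 'a"
  assumes "normal_operator A"
    and "is_spectral_measure A E"
    and "L2_isomorphism (restrict_space (scalar_measure E g) (spectrum A))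
           (\<lambda>f. spectral_integral E (spectrum A) f g)
           (closure (krylov A g))"
  shows "krylov_reduced A g"
proof -
  let ?M = "restrict_space (scalar_measure E g) (spectrum A)"
  have pvm: "projection_valued_measure E" and supp: "E (spectrum A) = id"
    and A: "\<And>x. has_spectral_integral E (spectrum A) (\<lambda>z. z) x (A x)"
    using assms(2) by (auto simp: is_spectral_measure_def)
  note S = spectrum_borel[OF assms(2)]
  define G where "G = {E X g | X. X \<in> sets borel}"
  \<comment> \<open>If \<open>V\<close> is invariant under \<open>E\<close>, then so is its
    complement, and \<open>A x\<close> is a spectral integral at \<open>x\<close>; closedness of the
    complement does the rest.\<close>
  have A_invariant: "A ` cortho V \<subseteq> cortho V"
    if "\<And>X v. X \<in> sets borel \<Longrightarrow> v \<in> V \<Longrightarrow> E X v \<in> V" for V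
    using has_spectral_integral_mem[OF pvm subspace_cortho closed_cortho _ A]
      cortho_pvm_invariant[OF pvm that] by blast
  have G_invariant: "E X v \<in> G" if "X \<in> sets borel" "v \<in> G" for X v
    using that unfolding G_def by (auto simp: pvm_Int[OF pvm])

  have G_subset: "G \<subseteq> closure (krylov A g)"
  proof -
    have "E X g \<in> closure (krylov A g)" if X: "X \<in> sets borel" for X
    proof -
      \<comment> \<open>The scalar measure is finite, so bounded measurable functions such as
        indicators belong to \<open>L2\<close>.\<close>
      interpret finite_measure ?M
        using S by (simp add: finite_measure_restrict_space finite_scalar_measure[OF pvm])
      have meas: "(indicator X :: complex \<Rightarrow> complex) \<in> borel_measurable ?M"
        using X by (intro measurable_restrict_space1) simp
      moreover have "integrable ?M (\<lambda>z. (cmod (indicator X z))\<^sup>2)"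
      proof (rule integrable_const_bound[of _ 1])
        show "(\<lambda>z. (cmod (indicator X z))\<^sup>2) \<in> borel_measurable ?M"
          by (intro borel_measurable_power measurable_compose[OF meas borel_measurable_norm])
      qed (simp add: indicator_def)
      ultimately have "indicator X \<in> L2 ?M"
        by (simp add: L2_def)
      then have "spectral_integral E (spectrum A) (indicator X) g \<in> closure (krylov A g)"
        using assms(3) by (simp add: L2_isomorphism_def)
      also have "spectral_integral E (spectrum A) (indicator X) g = E (spectrum A \<inter> X) g"
        by (rule spectral_integral_indicator[OF pvm S X])
      \<comment> \<open>Multiplicativity together with \<open>E (spectrum A) = id\<close> removes
        the restriction to the spectrum.\<close>
      also have "\<dots> = E X g"
        using pvm_Int[OF pvm S X, of g] supp by simp
      finally show ?thesis .
    qed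
    then show ?thesis
      by (auto simp: G_def)
  qed

  \<comment> \<open>The double complement is a subspace that contains \<open>G\<close>, hence
    \<open>g\<close>; two uses of \<open>cortho_pvm_invariant\<close> make
    \<open>A_invariant\<close> applicable to it.\<close>
  have "krylov A g \<subseteq> cortho (cortho G)"
  proof (rule krylov_subset)
    have "g \<in> G"
      using pvm_UNIV[OF pvm, of g] unfolding G_def by force
    then show "g \<in> cortho (cortho G)"
      by (auto simp: cortho_def cinner_eq_0_commute)
    show "A ` cortho (cortho G) \<subseteq> cortho (cortho G)"
      by (intro A_invariant cortho_pvm_invariant[OF pvm G_invariant])
  qed (rule subspace_cortho)
  \<comment> \<open>Each vector of \<open>cortho G\<close> is orthogonal to the double complement,
    hence to the Krylov space inside it.\<close>
  then have "cortho G \<subseteq> cortho (krylov A g)"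
    unfolding cortho_def using cinner_eq_0_commute by blast
  moreover have "cortho (krylov A g) \<subseteq> cortho G"
    using cortho_antimono[OF G_subset] by (simp add: cortho_closure)
  moreover have "A ` cortho G \<subseteq> cortho G"
    by (intro A_invariant G_invariant)
  ultimately have "A ` cortho (krylov A g) \<subseteq> cortho (krylov A g)"
    by blast
  moreover have "A ` closure (krylov A g) \<subseteq> closure (krylov A g)"
    using assms(1) by (intro closure_krylov_invariant) (simp add: normal_operator_def)
  ultimately show ?thesis
    by (simp add: krylov_reduced_def)
qed

end
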